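(* For any joint distribution $P_{XY}$ on alphabets $\mathcal{X}$ and $\mathcal{Y}$, the variance leakage from $X$ to $Y$ is $$\mathcal{L}^v(X\to Y)=-\log\big(1-\rho_m^2(X;Y)\big),$$ where $\rho_m(X;Y)$ is the (Hirschfeld–Gebelein–Rényi) maximal correlation.
   Context: $\log$ is the natural logarithm. The variance leakage is $$\mathcal{L}^v(X\to Y)=\sup_{\substack{U:\,U-X-Y\\ \mathrm{var}(U)>0}}\log\frac{\mathrm{var}(U)}{\mathbf{E}[(U-\mathbf{E}[U|Y])^2]},$$ where $U$ ranges over real-valued random variables (of finite variance) forming a Markov chain $U-X-Y$. The maximal correlation is $$\rho_m(X;Y)=\sup\ \mathbf{E}[f(X)g(Y)],$$ the supremum being over real functions $f,g$ with $\mathbf{E}[f(X)]=\mathbf{E}[g(Y)]=0$ and $\mathbf{E}[f(X)^2]=\mathbf{E}[g(Y)^2]=1$ (and $\rho_m=0$ if no such pair exists). The value $-\log 0$ is $+\infty$, and a ratio with zero denominator is $+\infty$. *)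

theory Defs
  imports "HOL-Probability.Probability"
begin

text \<open>Natural logarithm on the extended reals, with \<open>ln 0 = -\<infinity>\<close> and \<open>ln \<infinity> = \<infinity>\<close>.
  The value at negative arguments is a dummy.\<close>

definition ereal_ln :: "ereal \<Rightarrow> ereal" where
  "ereal_ln x = (if x = \<infinity> then \<infinity> else if x \<le> 0 then -\<infinity> else ereal (ln (real_of_ereal x)))"

definition cond_expect ::
    "'w measure \<Rightarrow> 'v measure \<Rightarrow> ('w \<Rightarrow> 'v) \<Rightarrow> ('w \<Rightarrow> real) \<Rightarrow> 'w \<Rightarrow> real" where
  "cond_expect M N V Z = real_cond_exp M (vimage_algebra (space M) V N) Z"

text \<open>\<open>U - X - Y\<close> is a Markov chain iff \<open>U\<close> and \<open>Y\<close> are conditionally independent given \<open>X\<close>;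
  the conditional probabilities are conditional expectations of indicators, so that no regular
  conditional distributions are needed.\<close>

definition markov_chain ::
    "'w measure \<Rightarrow> 'u measure \<Rightarrow> 'x measure \<Rightarrow> 'y measure \<Rightarrow>
     ('w \<Rightarrow> 'u) \<Rightarrow> ('w \<Rightarrow> 'x) \<Rightarrow> ('w \<Rightarrow> 'y) \<Rightarrow> bool" where
  "markov_chain M R S T U X Y \<longleftrightarrow>
     U \<in> measurable M R \<and> X \<in> measurable M S \<and> Y \<in> measurable M T \<and>
     (\<forall>A\<in>sets R. \<forall>B\<in>sets T. AE w in M.
        cond_expect M S X (\<lambda>w. indicator A (U w) * indicator B (Y w)) w =
        cond_expect M S X (\<lambda>w. indicator A (U w)) w *
        cond_expect M S X (\<lambda>w. indicator B (Y w)) w)"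

definition mmse :: "'w measure \<Rightarrow> 'y measure \<Rightarrow> ('w \<Rightarrow> real) \<Rightarrow> ('w \<Rightarrow> 'y) \<Rightarrow> real" where
  "mmse M T U Y = prob_space.expectation M (\<lambda>w. (U w - cond_expect M T Y U w)\<^sup>2)"

text \<open>The variable \<open>U\<close> may live on any probability space carrying a pair \<open>(X, Y)\<close> with law \<open>P\<close>.
  Since only the joint law of \<open>(U, X, Y)\<close> matters, the supremum is taken over these laws, that is,
  over the probability measures \<open>Q\<close> on \<open>\<real> \<times> \<X> \<times> \<Y>\<close> whose \<open>(\<X> \<times> \<Y>)\<close>-marginal is \<open>P\<close>;
  \<open>U\<close>, \<open>X\<close>, \<open>Y\<close> are then the coordinate projections.\<close>

definition leakage_laws ::
    "'x measure \<Rightarrow> 'y measure \<Rightarrow> ('x \<times> 'y) measure \<Rightarrow> (real \<times> 'x \<times> 'y) measure set" where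
  "leakage_laws S T P =
     {Q. prob_space Q \<and>
         sets Q = sets (borel \<Otimes>\<^sub>M (S \<Otimes>\<^sub>M T)) \<and>
         distr Q (S \<Otimes>\<^sub>M T) (\<lambda>(u, x, y). (x, y)) = P \<and>
         markov_chain Q borel S T (\<lambda>(u, x, y). u) (\<lambda>(u, x, y). x) (\<lambda>(u, x, y). y) \<and>
         integrable Q (\<lambda>(u, x, y). u\<^sup>2) \<and>
         prob_space.variance Q (\<lambda>(u, x, y). u) > 0}"

text \<open>The quotient is taken in \<^typ>\<open>ereal\<close>, where \<open>v / 0 = \<infinity>\<close> for \<open>v > 0\<close>.\<close>

definition variance_leakage :: "'x measure \<Rightarrow> 'y measure \<Rightarrow> ('x \<times> 'y) measure \<Rightarrow> ereal" where
  "variance_leakage S T P =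
     (SUP Q \<in> leakage_laws S T P.
        ereal_ln (ereal (prob_space.variance Q (\<lambda>(u, x, y). u)) /
                  ereal (mmse Q T (\<lambda>(u, x, y). u) (\<lambda>(u, x, y). y))))"

text \<open>The second-moment conditions force \<open>f(X)\<close> and \<open>g(Y)\<close> to be square integrable, because the
  Bochner integral of a non-integrable function is \<open>0\<close>; hence all the expectations below are
  genuine, and the correlations are bounded by \<open>1\<close>.\<close>

definition correlations :: "'x measure \<Rightarrow> 'y measure \<Rightarrow> ('x \<times> 'y) measure \<Rightarrow> real set" where
  "correlations S T P =
     {prob_space.expectation P (\<lambda>(x, y). f x * g y) | f g.
        f \<in> borel_measurable S \<and> g \<in> borel_measurable T \<and>
        prob_space.expectation P (\<lambda>(x, y). f x) = 0 \<and>
        prob_space.expectation P (\<lambda>(x, y). g y) = 0 \<and>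
        prob_space.expectation P (\<lambda>(x, y). (f x)\<^sup>2) = 1 \<and>
        prob_space.expectation P (\<lambda>(x, y). (g y)\<^sup>2) = 1}"

definition maximal_correlation :: "'x measure \<Rightarrow> 'y measure \<Rightarrow> ('x \<times> 'y) measure \<Rightarrow> real" where
  "maximal_correlation S T P =
     (if correlations S T P = {} then 0 else Sup (correlations S T P))"

end

(* For a Markov chain U - X - Y one has E[U|Y] = E[E[U|X]|Y]. Hence, with f(X) = E[U|X] - E[U] and
   g(Y) = E[U|Y] - E[U], the variance of E[U|Y] equals E[f(X) g(Y)], which is at most
   \<rho> * |f(X)| * |g(Y)| in L2 norms; so var(E[U|Y]) <= \<rho>^2 * var(U), and the mean square error is
   var(U) - var(E[U|Y]) >= (1 - \<rho>^2) * var(U). Conversely, a normalised pair f, g with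
   correlation c makes U = f(X) a competitor of leakage at least - log (1 - c^2). A fair coin
   independent of (X, Y) shows that the leakage is never negative, which settles the case where
   no normalised pair exists. *)

theory Submission
  imports Defs
begin

text \<open>\<rho> is the norm of the operator that sends a centred f(X) in L2 to E[f(X)|Y], so
  \<rho>^2 bounds the fraction of var(U) that Y explains. Randomness of U beyond X cannot raise this
  fraction: it adds to var(U) but disappears in E[U|X]. Three gaps shape the proof. The Markov
  property speaks of indicators only and offers no regular conditional distributions, while the
  tower identity is needed for unbounded U. Conditional expectations are functions on the sample
  space, while correlations pair functions on the alphabets; a Doob-Dynkin factorisation translates.
  Finally, the supremum in \<rho> need not be attained and \<rho> may be 1. The lower bound on the
  leakage therefore inverts the logarithm: a finite leakage l caps every correlation by sqrt (1 -
  exp (- l)), and such a cap passes to the supremum without a limit or a maximiser.\<close>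

section \<open>Square-integrable functions\<close>

lemma integrable_mult_of_squares:
  fixes f g :: "'a \<Rightarrow> real"
  assumes [measurable]: "f \<in> borel_measurable M" "g \<in> borel_measurable M"
    and "integrable M (\<lambda>x. (f x)\<^sup>2)" "integrable M (\<lambda>x. (g x)\<^sup>2)"
  shows "integrable M (\<lambda>x. f x * g x)"
proof (rule Bochner_Integration.integrable_bound)
  show "integrable M (\<lambda>x. (f x)\<^sup>2 + (g x)\<^sup>2)"
    using assms by simp
  have "\<bar>a * b\<bar> \<le> a\<^sup>2 + b\<^sup>2" for a b :: real
    using sum_squares_bound[of "\<bar>a\<bar>" "\<bar>b\<bar>"] abs_ge_zero[of "a * b"]
    unfolding power2_abs mult.assoc abs_mult[symmetric] by linarith
  then show "AE x in M. norm (f x * g x) \<le> norm ((f x)\<^sup>2 + (g x)\<^sup>2)"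
    by simp
qed simp

lemma (in finite_measure) integrable_of_square:
  fixes f :: "'a \<Rightarrow> real"
  assumes "f \<in> borel_measurable M" "integrable M (\<lambda>x. (f x)\<^sup>2)"
  shows "integrable M f"
  using integrable_mult_of_squares[of f M "\<lambda>_. 1"] assms by simp

lemma integrable_diff_power2:
  fixes f g :: "'a \<Rightarrow> real"
  assumes [measurable]: "f \<in> borel_measurable M" "g \<in> borel_measurable M"
    and "integrable M (\<lambda>x. (f x)\<^sup>2)" "integrable M (\<lambda>x. (g x)\<^sup>2)"
  shows "integrable M (\<lambda>x. (f x - g x)\<^sup>2)"
  using assms integrable_mult_of_squares[OF assms] by (simp add: power2_diff mult.assoc)

text \<open>Bessel's inequality for one unit vector: the residual of projecting \<open>f\<close>
  onto \<open>g\<close> has nonnegative square norm.\<close>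

lemma inner_unit_power2_le:
  fixes f g :: "'a \<Rightarrow> real"
  assumes [measurable]: "f \<in> borel_measurable M" "g \<in> borel_measurable M"
    and [simp]: "integrable M (\<lambda>x. (f x)\<^sup>2)" "integrable M (\<lambda>x. (g x)\<^sup>2)"
    and g: "(\<integral>x. (g x)\<^sup>2 \<partial>M) = 1"
  shows "(\<integral>x. f x * g x \<partial>M)\<^sup>2 \<le> (\<integral>x. (f x)\<^sup>2 \<partial>M)"
proof -
  define c where "c = (\<integral>x. f x * g x \<partial>M)"
  have [simp]: "integrable M (\<lambda>x. f x * g x)"
    by (rule integrable_mult_of_squares) simp_all
  have "0 \<le> (\<integral>x. (f x - c * g x)\<^sup>2 \<partial>M)"
    by simp
  also have "(\<lambda>x. (f x - c * g x)\<^sup>2) = (\<lambda>x. (f x)\<^sup>2 - (2 * c) * (f x * g x) + c\<^sup>2 * (g x)\<^sup>2)"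
    by (auto simp: power2_eq_square algebra_simps)
  also have "(\<integral>x. \<dots> x \<partial>M) = (\<integral>x. (f x)\<^sup>2 \<partial>M) - c\<^sup>2"
    by (simp add: g flip: c_def) (simp add: power2_eq_square)
  finally show ?thesis
    by (simp add: c_def)
qed

section \<open>Doob-Dynkin factorisation\<close>

text \<open>The sets of \<open>vimage_algebra\<close> are preimages under \<open>V\<close>, so
  indicators factor through \<open>V\<close>; induction over nonnegative measurable functions does
  the rest. In the limit step the factors are increasing only on the image of \<open>V\<close>, but
  their supremum is measurable everywhere.\<close>

lemma doob_dynkin_ennreal:
  fixes u :: "'a \<Rightarrow> ennreal"
  assumes V: "V \<in> \<Omega> \<rightarrow> space N" and "u \<in> borel_measurable (vimage_algebra \<Omega> V N)"
  shows "\<exists>g\<in>borel_measurable N. \<forall>w\<in>\<Omega>. u w = g (V w)"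
  using assms(2)
proof (induct rule: borel_measurable_induct)
  case (cong f g)
  then show ?case by (simp cong: ball_cong)
next
  case (set A)
  then obtain B where "B \<in> sets N" "A = V -` B \<inter> \<Omega>"
    using sets_vimage_algebra2[OF V] by auto
  then show ?case
    by (intro bexI[of _ "indicator B"] ballI) (simp_all add: indicator_def)
next
  case (mult u c)
  from mult(4) obtain g where "g \<in> borel_measurable N" "\<forall>w\<in>\<Omega>. u w = g (V w)"
    by blast
  then show ?case
    by (intro bexI[of _ "\<lambda>y. c * g y"]) simp_all
next
  case (add u v)
  from add(3,7) obtain g h where "g \<in> borel_measurable N" "\<forall>w\<in>\<Omega>. u w = g (V w)"
    "h \<in> borel_measurable N" "\<forall>w\<in>\<Omega>. v w = h (V w)"
    by blast
  then show ?case
    by (intro bexI[of _ "\<lambda>y. h y + g y"]) simp_all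
next
  case (seq U)
  from seq(3) obtain g where g: "\<And>i. g i \<in> borel_measurable N" "\<And>i w. w \<in> \<Omega> \<Longrightarrow> U i w = g i (V w)"
    by metis
  show ?case
  proof (intro bexI[of _ "\<lambda>y. SUP i. g i y"] ballI)
    fix w assume "w \<in> \<Omega>"
    then show "(SUP i. U i) w = (SUP i. g i (V w))"
      by (simp add: image_image g(2))
  next
    show "(\<lambda>y. SUP i. g i y) \<in> borel_measurable N"
      using g(1) by (intro borel_measurable_SUP) simp_all
  qed
qed

text \<open>\<open>ennreal\<close> sends negative reals to 0, so factoring \<open>u\<close> and
  \<open>- u\<close> separately factors the positive and the negative part.\<close>

lemma doob_dynkin:
  fixes u :: "'a \<Rightarrow> real"
  assumes V: "V \<in> \<Omega> \<rightarrow> space N" and [measurable]: "u \<in> borel_measurable (vimage_algebra \<Omega> V N)"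
  obtains g where "g \<in> borel_measurable N" "\<And>w. w \<in> \<Omega> \<Longrightarrow> u w = g (V w)"
proof -
  obtain p where p: "p \<in> borel_measurable N" "\<forall>w\<in>\<Omega>. ennreal (u w) = p (V w)"
    using doob_dynkin_ennreal[OF V, of "\<lambda>w. ennreal (u w)"] by auto
  obtain q where q: "q \<in> borel_measurable N" "\<forall>w\<in>\<Omega>. ennreal (- u w) = q (V w)"
    using doob_dynkin_ennreal[OF V, of "\<lambda>w. ennreal (- u w)"] by auto
  show thesis
  proof
    show "(\<lambda>y. enn2real (p y) - enn2real (q y)) \<in> borel_measurable N"
      using p(1) q(1) by measurable
    fix w assume "w \<in> \<Omega>"
    then have "p (V w) = ennreal (u w)" "q (V w) = ennreal (- u w)"
      using p(2) q(2) by auto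
    then show "u w = enn2real (p (V w)) - enn2real (q (V w))"
      by (cases "0 \<le> u w") (simp_all add: ennreal_neg)
  qed
qed

section \<open>Conditional expectation in L2\<close>

lemma (in finite_measure) finite_measure_subalgebra_vimage:
  assumes "V \<in> measurable M N"
  shows "finite_measure_subalgebra M (vimage_algebra (space M) V N)"
proof (unfold_locales)
  show "subalgebra M (vimage_algebra (space M) V N)"
    unfolding subalgebra_def
    using assms sets_vimage_algebra2[of V "space M" N] by (auto simp: measurable_def)
qed

context sigma_finite_subalgebra
begin

lemma measurable_subalg[measurable_dest]: "f \<in> measurable F N \<Longrightarrow> f \<in> measurable M N"
  by (rule measurable_from_subalg[OF subalg])

end

context finite_measure_subalgebra
begin

lemma integrable_real_cond_exp_power2:
  assumes "U \<in> borel_measurable M" "integrable M (\<lambda>x. (U x)\<^sup>2)"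
  shows "integrable M (\<lambda>x. (real_cond_exp M F U x)\<^sup>2)"
proof -
  \<comment> \<open>The conditional Jensen inequality \<open>integrable_convex_cond_exp\<close> asks
    for an interval of one of four shapes. The last shape is the one meant; the endpoints 0 merely
    instantiate the others.\<close>
  have UNIV: "(UNIV :: real set) = {0<..<0} \<or> (UNIV :: real set) = {0<..} \<or>
      (UNIV :: real set) = {..<0} \<or> (UNIV :: real set) = UNIV"
    by (intro disjI2 refl)
  have [measurable]: "(\<lambda>x. x\<^sup>2) \<in> borel_measurable (borel :: real measure)"
    by measurable
  show ?thesis
    by (rule integrable_convex_cond_exp[OF integrable_of_square[OF assms] _ UNIV assms(2) convex_power2])
      simp_all
qed

text \<open>Pythagoras for U - m = (U - G) + (G - m): the summands are orthogonal because G - m is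
  \<open>F\<close>-measurable. The constant \<open>m\<close> is left free, since both the mean and 0
  are used as centres.\<close>

lemma integral_real_cond_exp_centered_power2:
  fixes U :: "'a \<Rightarrow> real" and m :: real
  defines "G \<equiv> \<lambda>x. real_cond_exp M F U x"
  assumes [measurable]: "U \<in> borel_measurable M" and U2: "integrable M (\<lambda>x. (U x)\<^sup>2)"
  shows "(\<integral>x. (U x - G x)\<^sup>2 \<partial>M) = (\<integral>x. (U x - m)\<^sup>2 \<partial>M) - (\<integral>x. (G x - m)\<^sup>2 \<partial>M)"
proof -
  have G2: "integrable M (\<lambda>x. (G x)\<^sup>2)"
    unfolding G_def by (rule integrable_real_cond_exp_power2) fact+
  have [measurable]: "G \<in> borel_measurable F" "G \<in> borel_measurable M"
    unfolding G_def by simp_all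
  have [simp]: "integrable M (\<lambda>x. (U x - m)\<^sup>2)" "integrable M (\<lambda>x. (G x - m)\<^sup>2)"
    using integrable_diff_power2[of U M "\<lambda>_. m"] integrable_diff_power2[of G M "\<lambda>_. m"] U2 G2
    by simp_all
  have [simp]: "integrable M (\<lambda>x. (G x - m) * (U x - m))"
    by (rule integrable_mult_of_squares) simp_all
  have "integrable M (\<lambda>x. (G x - m) * U x)"
    by (rule integrable_mult_of_squares) (simp_all add: U2)
  from real_cond_exp_intg[OF this]
  have 1: "(\<integral>x. (G x - m) * G x \<partial>M) = (\<integral>x. (G x - m) * U x \<partial>M)"
    and [simp]: "integrable M (\<lambda>x. (G x - m) * G x)" "integrable M (\<lambda>x. (G x - m) * U x)"
    using \<open>integrable M (\<lambda>x. (G x - m) * U x)\<close> by (simp_all add: G_def)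
  have [simp]: "integrable M (\<lambda>x. G x - m)"
    by (rule integrable_of_square) simp_all
  have "(\<integral>x. (G x - m) * (U x - m) \<partial>M) = (\<integral>x. (G x - m) * U x - m * (G x - m) \<partial>M)"
    by (simp add: algebra_simps)
  also have "\<dots> = (\<integral>x. (G x - m) * G x - m * (G x - m) \<partial>M)"
    by (subst (1 2) Bochner_Integration.integral_diff) (simp_all add: 1)
  also have "\<dots> = (\<integral>x. (G x - m)\<^sup>2 \<partial>M)"
    by (simp add: algebra_simps power2_eq_square)
  finally have 2: "(\<integral>x. (G x - m) * (U x - m) \<partial>M) = (\<integral>x. (G x - m)\<^sup>2 \<partial>M)" .
  have "(\<lambda>x. (U x - G x)\<^sup>2) = (\<lambda>x. (U x - m)\<^sup>2 - 2 * ((G x - m) * (U x - m)) + (G x - m)\<^sup>2)"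
    by (auto simp: power2_eq_square algebra_simps)
  then show ?thesis
    by (simp add: 2)
qed

end

section \<open>Consequences of the Markov property\<close>

text \<open>For fixed \<open>B\<close>, the Markov property says that the law of \<open>U\<close> is the same under the densities
  \<open>1\<^sub>B(Y)\<close> and \<open>E[1\<^sub>B(Y) | X]\<close>; hence every integrable function of \<open>U\<close> has the same integral
  under both.\<close>

lemma (in prob_space) markov_chain_tower:
  assumes mc: "markov_chain M borel S T U X Y" and U: "integrable M (U :: 'a \<Rightarrow> real)"
  shows "AE w in M. cond_expect M T Y (cond_expect M S X U) w = cond_expect M T Y U w"
proof -
  define FX where "FX = vimage_algebra (space M) X S"
  define FY where "FY = vimage_algebra (space M) Y T"
  have [measurable]: "U \<in> borel_measurable M" "X \<in> measurable M S" and Y[measurable]: "Y \<in> measurable M T"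
    using mc by (auto simp: markov_chain_def)
  interpret FX: finite_measure_subalgebra M FX
    unfolding FX_def by (rule finite_measure_subalgebra_vimage) simp
  interpret FY: finite_measure_subalgebra M FY
    unfolding FY_def by (rule finite_measure_subalgebra_vimage) simp
  \<comment> \<open>Every set of \<sigma>(Y) is a preimage of some \<open>B\<close>, so this
    identity says that U and E[U|X] have the same integrals over \<sigma>(Y), which determines their
    conditional expectations given Y.\<close>
  have key: "(\<integral>w. indicator B (Y w) * real_cond_exp M FX U w \<partial>M) = (\<integral>w. indicator B (Y w) * U w \<partial>M)"
    if B[measurable]: "B \<in> sets T" for B
  proof -
    define b :: "'a \<Rightarrow> real" where "b w = indicator B (Y w)" for w
    define e where "e = real_cond_exp M FX b"
    have [measurable]: "b \<in> borel_measurable M" "e \<in> borel_measurable FX" "e \<in> borel_measurable M"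
      unfolding b_def e_def by measurable
    have b01: "0 \<le> b w" "b w \<le> 1" for w
      by (simp_all add: b_def)
    have [simp]: "integrable M b"
      by (rule integrable_const_bound[of _ 1]) (use b01 in auto)
    have e01: "AE w in M. 0 \<le> e w" "AE w in M. e w \<le> 1"
      unfolding e_def by (intro FX.real_cond_exp_ge_c FX.real_cond_exp_le_c; use b01 in simp)+
    have bnd: "integrable M (\<lambda>w. b w * h w)" "integrable M (\<lambda>w. e w * h w)"
      if "integrable M h" for h :: "'a \<Rightarrow> real"
    proof -
      have [measurable]: "h \<in> borel_measurable M" using that by simp
      show "integrable M (\<lambda>w. b w * h w)"
        by (rule Bochner_Integration.integrable_bound[OF that])
          (use b01 in \<open>auto simp: abs_mult intro!: mult_left_le_one_le\<close>)
      show "integrable M (\<lambda>w. e w * h w)"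
        by (rule Bochner_Integration.integrable_bound[OF that])
          (use e01 in \<open>auto simp: abs_mult intro!: mult_left_le_one_le\<close>)
    qed
    have laws: "distr (density M b) borel U = distr (density M e) borel U"
    proof (rule measure_eqI)
      fix A assume "A \<in> sets (distr (density M b) borel U)"
      then have A[measurable]: "A \<in> sets borel" by simp
      define a :: "'a \<Rightarrow> real" where "a w = indicator A (U w)" for w
      have [measurable]: "a \<in> borel_measurable M" unfolding a_def by measurable
      have a01: "0 \<le> a w" "a w \<le> 1" for w
        by (simp_all add: a_def)
      have [simp]: "integrable M a"
        by (rule integrable_const_bound[of _ 1]) (use a01 in auto)
      have "(\<integral>w. b w * a w \<partial>M) = (\<integral>w. real_cond_exp M FX (\<lambda>w. a w * b w) w \<partial>M)"
        using bnd[of a] by (subst FX.real_cond_exp_int) (simp_all add: mult.commute)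
      \<comment> \<open>Conditional independence enters only here, for the pair of indicators
        \<open>a\<close> and \<open>b\<close>. The next equation undoes the conditioning of
        \<open>a\<close>, because \<open>e\<close> is already a function of X.\<close>
      also have "\<dots> = (\<integral>w. real_cond_exp M FX a w * e w \<partial>M)"
        using mc A B unfolding markov_chain_def cond_expect_def
        by (intro integral_cong_AE) (simp_all add: FX_def a_def[abs_def] b_def[abs_def] e_def)
      also have "\<dots> = (\<integral>w. e w * a w \<partial>M)"
        using bnd[of a] FX.real_cond_exp_intg(2)[of e a] by (simp add: mult.commute)
      finally have "(\<integral>w. b w * a w \<partial>M) = (\<integral>w. e w * a w \<partial>M)" .
      then have "(\<integral>\<^sup>+w. ennreal (b w * a w) \<partial>M) = (\<integral>\<^sup>+w. ennreal (e w * a w) \<partial>M)"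
        using bnd[of a] e01(1) a01 b01 by (subst (1 2) nn_integral_eq_integral) auto
      moreover have "ennreal (h * a w) = ennreal h * indicator (U -` A \<inter> space M) w"
        if "w \<in> space M" for h w
        using that by (auto simp: a_def indicator_def)
      ultimately have "(\<integral>\<^sup>+w. ennreal (b w) * indicator (U -` A \<inter> space M) w \<partial>M) =
          (\<integral>\<^sup>+w. ennreal (e w) * indicator (U -` A \<inter> space M) w \<partial>M)"
        by (simp cong: nn_integral_cong)
      then show "emeasure (distr (density M b) borel U) A = emeasure (distr (density M e) borel U) A"
        by (simp add: emeasure_distr emeasure_density)
    qed simp
    have "(\<integral>w. b w * U w \<partial>M) = (\<integral>u. u \<partial>distr (density M b) borel U)"
      using b01 by (simp add: integral_distr integral_density)
    also have "\<dots> = (\<integral>w. e w * U w \<partial>M)"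
      unfolding laws using e01 by (simp add: integral_distr integral_density)
    \<comment> \<open>Self-adjointness of conditioning on X: first U is replaced by E[U|X] against
      the \<open>FX\<close>-measurable \<open>e\<close>, then \<open>e\<close> by \<open>b\<close>
      against the \<open>FX\<close>-measurable E[U|X].\<close>
    also have "\<dots> = (\<integral>w. e w * real_cond_exp M FX U w \<partial>M)"
      using FX.real_cond_exp_intg(2)[of e U] bnd[OF U] by simp
    also have "\<dots> = (\<integral>w. real_cond_exp M FX U w * b w \<partial>M)"
      using FX.real_cond_exp_intg(2)[of "real_cond_exp M FX U" b] bnd[OF FX.real_cond_exp_int(1)[OF U]]
      by (simp add: e_def mult.commute)
    finally show ?thesis
      by (simp add: b_def mult.commute)
  qed
  have "AE w in M. real_cond_exp M FY (real_cond_exp M FX U) w = real_cond_exp M FY U w"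
  proof (rule FY.real_cond_exp_charact)
    fix D assume D: "D \<in> sets FY"
    then obtain B where B: "B \<in> sets T" "D = Y -` B \<inter> space M"
      using sets_vimage_algebra2[of Y "space M" T] Y by (auto simp: FY_def measurable_def)
    have ind: "indicator D w = (indicator B (Y w) :: real)" if "w \<in> space M" for w
      using that B by (auto simp: indicator_def)
    have "(\<integral>w\<in>D. real_cond_exp M FX U w \<partial>M) = (\<integral>w\<in>D. U w \<partial>M)"
      using key[OF B(1)] by (simp add: set_lebesgue_integral_def ind cong: Bochner_Integration.integral_cong)
    also have "\<dots> = (\<integral>w\<in>D. real_cond_exp M FY U w \<partial>M)"
      by (rule FY.real_cond_exp_intA[OF U D])
    finally show "(\<integral>w\<in>D. real_cond_exp M FX U w \<partial>M) = (\<integral>w\<in>D. real_cond_exp M FY U w \<partial>M)" .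
  qed (use U FX.real_cond_exp_int FY.real_cond_exp_int in auto)
  then show ?thesis
    by (simp add: cond_expect_def FX_def FY_def)
qed

text \<open>The correlation bound is a hypothesis about X and Y on \<open>M\<close> itself, so the
  L2 argument never mentions their joint law or the supremum over pairs.\<close>

lemma (in prob_space) markov_chain_cond_expect_power2_le:
  fixes U :: "'a \<Rightarrow> real"
  assumes mc: "markov_chain M borel S T U X Y" and U2: "integrable M (\<lambda>w. (U w)\<^sup>2)"
    and "0 \<le> \<rho>"
    and bound: "\<And>f g. f \<in> borel_measurable S \<Longrightarrow> g \<in> borel_measurable T \<Longrightarrow>
      expectation (\<lambda>w. f (X w)) = 0 \<Longrightarrow> expectation (\<lambda>w. g (Y w)) = 0 \<Longrightarrow>
      expectation (\<lambda>w. (f (X w))\<^sup>2) = 1 \<Longrightarrow> expectation (\<lambda>w. (g (Y w))\<^sup>2) = 1 \<Longrightarrow>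
      expectation (\<lambda>w. f (X w) * g (Y w)) \<le> \<rho>"
  shows "expectation (\<lambda>w. (cond_expect M T Y U w - expectation U)\<^sup>2) \<le> \<rho>\<^sup>2 * variance U"
proof -
  define FX where "FX = vimage_algebra (space M) X S"
  define FY where "FY = vimage_algebra (space M) Y T"
  have [measurable]: "U \<in> borel_measurable M"
    and X[measurable]: "X \<in> measurable M S" and Y[measurable]: "Y \<in> measurable M T"
    using mc by (auto simp: markov_chain_def)
  interpret FX: finite_measure_subalgebra M FX
    unfolding FX_def by (rule finite_measure_subalgebra_vimage) simp
  interpret FY: finite_measure_subalgebra M FY
    unfolding FY_def by (rule finite_measure_subalgebra_vimage) simp
  have U: "integrable M U"
    by (rule integrable_of_square) (simp_all add: U2)
  define F where "F = real_cond_exp M FX U"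
  define G where "G = real_cond_exp M FY U"
  define m where "m = expectation U"
  have [measurable]: "F \<in> borel_measurable FX" "G \<in> borel_measurable FY"
    "F \<in> borel_measurable M" "G \<in> borel_measurable M"
    by (simp_all add: F_def G_def)
  have [simp]: "integrable M F" "integrable M G" "expectation F = m" "expectation G = m"
    using FX.real_cond_exp_int[OF U] FY.real_cond_exp_int[OF U] by (simp_all add: F_def G_def m_def)
  have F2: "integrable M (\<lambda>w. (F w)\<^sup>2)" and G2: "integrable M (\<lambda>w. (G w)\<^sup>2)"
    unfolding F_def G_def
    by (rule FX.integrable_real_cond_exp_power2 FY.integrable_real_cond_exp_power2;
        simp add: U2)+
  have Fm2[simp]: "integrable M (\<lambda>w. (F w - m)\<^sup>2)" and Gm2[simp]: "integrable M (\<lambda>w. (G w - m)\<^sup>2)"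
    using integrable_diff_power2[of F M "\<lambda>_. m"] integrable_diff_power2[of G M "\<lambda>_. m"] F2 G2
    by simp_all
  define a where "a = expectation (\<lambda>w. (F w - m)\<^sup>2)"
  define b where "b = expectation (\<lambda>w. (G w - m)\<^sup>2)"
  have "0 \<le> expectation (\<lambda>w. (U w - F w)\<^sup>2)"
    by simp
  then have a: "a \<le> variance U"
    using FX.integral_real_cond_exp_centered_power2[of U m] U2
    by (simp add: F_def a_def m_def)
  have b: "b = expectation (\<lambda>w. (F w - m) * (G w - m))"
  proof -
    have GF[simp]: "integrable M (\<lambda>w. (G w - m) * F w)" and GG[simp]: "integrable M (\<lambda>w. (G w - m) * G w)"
      by (rule integrable_mult_of_squares; simp add: F2 G2)+
    have "AE w in M. real_cond_exp M FY F w = G w"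
      using markov_chain_tower[OF mc U] by (simp add: cond_expect_def F_def G_def FX_def FY_def)
    then have "expectation (\<lambda>w. (G w - m) * G w) = expectation (\<lambda>w. (G w - m) * real_cond_exp M FY F w)"
      by (intro integral_cong_AE) auto
    also have "\<dots> = expectation (\<lambda>w. (G w - m) * F w)"
      by (rule FY.real_cond_exp_intg) simp_all
    finally have eq: "expectation (\<lambda>w. (G w - m) * G w) = expectation (\<lambda>w. (G w - m) * F w)" .
    have "(\<lambda>w. (G w - m)\<^sup>2) = (\<lambda>w. (G w - m) * G w - m * (G w - m))"
      "(\<lambda>w. (F w - m) * (G w - m)) = (\<lambda>w. (G w - m) * F w - m * (G w - m))"
      by (auto simp: algebra_simps power2_eq_square)
    then show ?thesis
      by (simp add: b_def eq)
  qed
  have "b \<le> \<rho>\<^sup>2 * a"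
  proof (cases "b = 0")
    case True
    then show ?thesis by (simp add: a_def)
  next
    case False
    then have "b > 0"
      by (simp add: b_def less_le)
    have Gb: "(\<lambda>w. ((G w - m) / sqrt b)\<^sup>2) = (\<lambda>w. (G w - m)\<^sup>2 / b)"
      using \<open>b > 0\<close> by (simp add: power_divide)
    \<comment> \<open>Pairing F - m with the unit vector (G - m) / sqrt b gives sqrt b, so Bessel
      yields b \<le> a. This serves to make \<open>a\<close> positive, so that F - m can be
      normalised too.\<close>
    have "(expectation (\<lambda>w. (F w - m) * ((G w - m) / sqrt b)))\<^sup>2 \<le> a"
      unfolding a_def using \<open>b > 0\<close>
      by (intro inner_unit_power2_le) (simp_all add: Gb flip: b_def)
    then have "b \<le> a"
      using \<open>b > 0\<close> by (simp add: b[symmetric] power_divide power2_eq_square)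
    with \<open>b > 0\<close> have "a > 0" by simp
    obtain f where f[measurable]: "f \<in> borel_measurable S" "\<And>w. w \<in> space M \<Longrightarrow> F w = f (X w)"
      by (rule doob_dynkin[of X "space M" S F])
        (use measurable_space[OF X] in \<open>auto simp: FX_def[symmetric]\<close>)
    obtain g where g[measurable]: "g \<in> borel_measurable T" "\<And>w. w \<in> space M \<Longrightarrow> G w = g (Y w)"
      by (rule doob_dynkin[of Y "space M" T G])
        (use measurable_space[OF Y] in \<open>auto simp: FY_def[symmetric]\<close>)
    define f' where "f' x = (f x - m) / sqrt a" for x
    define g' where "g' y = (g y - m) / sqrt b" for y
    have f': "f' (X w) = (F w - m) / sqrt a" and g': "g' (Y w) = (G w - m) / sqrt b"
      if "w \<in> space M" for w
      using f(2) g(2) that by (simp_all add: f'_def g'_def)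
    have "expectation (\<lambda>w. f' (X w) * g' (Y w)) \<le> \<rho>"
    proof (rule bound)
      show "f' \<in> borel_measurable S" "g' \<in> borel_measurable T"
        unfolding f'_def g'_def by measurable
    qed (use \<open>a > 0\<close> \<open>b > 0\<close> in \<open>simp_all add: f' g' power_divide prob_space
        flip: a_def b_def cong: Bochner_Integration.integral_cong\<close>)
    moreover have "expectation (\<lambda>w. f' (X w) * g' (Y w)) = b / (sqrt a * sqrt b)"
      by (simp add: f' g' flip: b cong: Bochner_Integration.integral_cong)
    \<comment> \<open>\<open>b\<close> is both the inner product and the square norm of G - m. One
      factor sqrt b therefore cancels, and squaring what remains produces \<rho>^2.\<close>
    ultimately have "b \<le> \<rho> * (sqrt a * sqrt b)"
      using \<open>a > 0\<close> \<open>b > 0\<close> by (simp add: pos_divide_le_eq)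
    then have "sqrt b * sqrt b \<le> (\<rho> * sqrt a) * sqrt b"
      using \<open>b > 0\<close> by (simp add: mult.assoc)
    then have "sqrt b \<le> \<rho> * sqrt a"
      by (rule mult_right_le_imp_le) (simp add: \<open>b > 0\<close>)
    then have "(sqrt b)\<^sup>2 \<le> (\<rho> * sqrt a)\<^sup>2"
      using \<open>b > 0\<close> by (intro power_mono) auto
    then show ?thesis
      using \<open>a > 0\<close> \<open>b > 0\<close> by (simp add: power_mult_distrib)
  qed
  also have "\<dots> \<le> \<rho>\<^sup>2 * variance U"
    using a by (intro mult_left_mono) auto
  finally show ?thesis
    by (simp add: b_def G_def m_def cond_expect_def FY_def)
qed

section \<open>The mean square error\<close>

lemma (in prob_space) mmse_eq:
  fixes U :: "'a \<Rightarrow> real"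
  assumes "U \<in> borel_measurable M" "integrable M (\<lambda>w. (U w)\<^sup>2)" and Y: "Y \<in> measurable M T"
  shows "mmse M T U Y = expectation (\<lambda>w. (U w - m)\<^sup>2) - expectation (\<lambda>w. (cond_expect M T Y U w - m)\<^sup>2)"
proof -
  interpret FY: finite_measure_subalgebra M "vimage_algebra (space M) Y T"
    by (rule finite_measure_subalgebra_vimage) fact
  show ?thesis
    unfolding mmse_def cond_expect_def
    by (rule FY.integral_real_cond_exp_centered_power2) fact+
qed

text \<open>Against g(Y), U and E[U|Y] have the same inner product. Bessel then bounds the second
  moment of E[U|Y] from below, and Pythagoras with centre 0 turns this into a bound on the
  error.\<close>

lemma (in prob_space) mmse_le_of_correlation:
  fixes U :: "'a \<Rightarrow> real"
  assumes [measurable]: "U \<in> borel_measurable M" "Y \<in> measurable M T" "g \<in> borel_measurable T"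
    and U2: "integrable M (\<lambda>w. (U w)\<^sup>2)" and g2: "expectation (\<lambda>w. (g (Y w))\<^sup>2) = 1"
  shows "mmse M T U Y \<le> expectation (\<lambda>w. (U w)\<^sup>2) - (expectation (\<lambda>w. U w * g (Y w)))\<^sup>2"
proof -
  define FY where "FY = vimage_algebra (space M) Y T"
  interpret FY: finite_measure_subalgebra M FY
    unfolding FY_def by (rule finite_measure_subalgebra_vimage) simp
  have "Y \<in> measurable FY T"
    unfolding FY_def using measurable_space[of Y M T] by (intro measurable_vimage_algebra1) auto
  then have [measurable]: "(\<lambda>w. g (Y w)) \<in> borel_measurable FY"
    by (rule measurable_compose) simp
  \<comment> \<open>A non-integrable function has Bochner integral 0, so the value 1 forces
    integrability.\<close>
  have [simp]: "integrable M (\<lambda>w. (g (Y w))\<^sup>2)"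
    using g2 not_integrable_integral_eq by fastforce
  have "integrable M (\<lambda>w. g (Y w) * U w)"
    by (rule integrable_mult_of_squares) (simp_all add: U2)
  from FY.real_cond_exp_intg(2)[OF this]
  have "expectation (\<lambda>w. U w * g (Y w)) = expectation (\<lambda>w. real_cond_exp M FY U w * g (Y w))"
    by (simp add: mult.commute)
  also have "\<dots>\<^sup>2 \<le> expectation (\<lambda>w. (real_cond_exp M FY U w)\<^sup>2)"
    by (rule inner_unit_power2_le) (simp_all add: FY.integrable_real_cond_exp_power2 U2 g2)
  finally show ?thesis
    using mmse_eq[of U Y T 0] U2 by (simp add: cond_expect_def FY_def)
qed

section \<open>Two sources of Markov chains\<close>

text \<open>A function of X can be pulled out of conditioning on X. Equality is only almost sure
  because U will be a coordinate projection, which agrees with f(X) only on the graph of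
  \<open>f\<close>.\<close>

lemma (in prob_space) markov_chain_of_function:
  assumes [measurable]: "U \<in> measurable M R" "X \<in> measurable M S" "Y \<in> measurable M T"
    "f \<in> measurable S R" and U: "AE w in M. U w = f (X w)"
  shows "markov_chain M R S T U X Y"
  unfolding markov_chain_def
proof (intro conjI ballI)
  fix A B assume [measurable]: "A \<in> sets R" "B \<in> sets T"
  define FX where "FX = vimage_algebra (space M) X S"
  interpret FX: finite_measure_subalgebra M FX
    unfolding FX_def by (rule finite_measure_subalgebra_vimage) simp
  have "X \<in> measurable FX S"
    unfolding FX_def using measurable_space[of X M S] by (intro measurable_vimage_algebra1) auto
  then have [measurable]: "(\<lambda>w. f (X w)) \<in> measurable FX R"
    by (rule measurable_compose) simp
  define a :: "'a \<Rightarrow> real" where "a w = indicator A (f (X w))" for w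
  define b :: "'a \<Rightarrow> real" where "b w = indicator B (Y w)" for w
  have [measurable]: "a \<in> borel_measurable FX" "b \<in> borel_measurable M" "a \<in> borel_measurable M"
    unfolding a_def b_def by measurable
  have "integrable M a" "integrable M (\<lambda>w. a w * b w)"
    by (rule integrable_const_bound[of _ 1]; simp add: a_def b_def indicator_def)+
  then have 1: "AE w in M. real_cond_exp M FX a w = a w"
    "AE w in M. real_cond_exp M FX (\<lambda>w. a w * b w) w = a w * real_cond_exp M FX b w"
    by (simp_all add: FX.real_cond_exp_mult)
  have Ua: "AE w in M. indicator A (U w) = a w"
    using U by eventually_elim (simp add: a_def)
  have 2: "AE w in M. real_cond_exp M FX (\<lambda>w. indicator A (U w)) w = real_cond_exp M FX a w"
    using Ua by (intro FX.real_cond_exp_cong) simp_all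
  have "AE w in M. real_cond_exp M FX (\<lambda>w. indicator A (U w) * b w) w = real_cond_exp M FX (\<lambda>w. a w * b w) w"
    using Ua by (intro FX.real_cond_exp_cong) auto
  with 1 2 show "AE w in M. cond_expect M S X (\<lambda>w. indicator A (U w) * indicator B (Y w)) w =
      cond_expect M S X (\<lambda>w. indicator A (U w)) w * cond_expect M S X (\<lambda>w. indicator B (Y w)) w"
    unfolding cond_expect_def FX_def[symmetric] b_def[symmetric]
    by eventually_elim simp
qed fact+

text \<open>Over a set {X \<in> B}, the integral of 1_A(U) 1_C(Y) splits off the factor p = P(U
  \<in> A), so conditioning on X also splits off \<open>p\<close>.\<close>

lemma (in prob_space) markov_chain_of_indep:
  assumes [measurable]: "U \<in> measurable M R" and X[measurable]: "X \<in> measurable M S"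
    and Y[measurable]: "Y \<in> measurable M T"
    and indep: "\<And>A B C. A \<in> sets R \<Longrightarrow> B \<in> sets S \<Longrightarrow> C \<in> sets T \<Longrightarrow>
      prob {w \<in> space M. U w \<in> A \<and> X w \<in> B \<and> Y w \<in> C} =
      prob {w \<in> space M. U w \<in> A} * prob {w \<in> space M. X w \<in> B \<and> Y w \<in> C}"
  shows "markov_chain M R S T U X Y"
  unfolding markov_chain_def
proof (intro conjI ballI)
  fix A B assume A[measurable]: "A \<in> sets R" and B[measurable]: "B \<in> sets T"
  define FX where "FX = vimage_algebra (space M) X S"
  interpret FX: finite_measure_subalgebra M FX
    unfolding FX_def by (rule finite_measure_subalgebra_vimage) simp
  define p where "p = prob {w \<in> space M. U w \<in> A}"
  have int: "integrable M (\<lambda>w. indicator C (Y w) :: real)" if [measurable]: "C \<in> sets T" for C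
    by (rule integrable_const_bound[of _ 1]) (simp_all add: indicator_def)
  have key: "AE w in M. real_cond_exp M FX (\<lambda>w. indicator A (U w) * indicator C (Y w)) w =
      p * real_cond_exp M FX (\<lambda>w. indicator C (Y w)) w" if C[measurable]: "C \<in> sets T" for C
  proof (rule FX.real_cond_exp_charact)
    show "integrable M (\<lambda>w. indicator A (U w) * indicator C (Y w) :: real)"
      by (rule integrable_const_bound[of _ 1]) (simp_all add: indicator_def)
    show "integrable M (\<lambda>w. p * real_cond_exp M FX (\<lambda>w. indicator C (Y w)) w)"
      using FX.real_cond_exp_int(1)[OF int[OF C]] by simp
    fix D assume D: "D \<in> sets FX"
    then obtain B where B[measurable]: "B \<in> sets S" "D = X -` B \<inter> space M"
      using sets_vimage_algebra2[of X "space M" S] X by (auto simp: FX_def measurable_def)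
    have "(\<integral>w\<in>D. (indicator A (U w) * indicator C (Y w) :: real) \<partial>M) =
        (\<integral>w. indicator {w \<in> space M. U w \<in> A \<and> X w \<in> B \<and> Y w \<in> C} w \<partial>M)"
      unfolding set_lebesgue_integral_def
      by (intro Bochner_Integration.integral_cong) (auto simp: B(2) indicator_def)
    also have "\<dots> = p * prob {w \<in> space M. X w \<in> B \<and> Y w \<in> C}"
      by (simp add: indep[OF A B(1) C] p_def Int_def conj_ac)
    also have "prob {w \<in> space M. X w \<in> B \<and> Y w \<in> C} =
        (\<integral>w. indicator {w \<in> space M. X w \<in> B \<and> Y w \<in> C} w \<partial>M)"
      by (simp add: Int_def conj_ac)
    also have "\<dots> = (\<integral>w\<in>D. (indicator C (Y w) :: real) \<partial>M)"
      unfolding set_lebesgue_integral_def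
      by (intro Bochner_Integration.integral_cong) (auto simp: B(2) indicator_def)
    also have "\<dots> = (\<integral>w\<in>D. real_cond_exp M FX (\<lambda>w. indicator C (Y w)) w \<partial>M)"
      by (rule FX.real_cond_exp_intA[OF int[OF C] D])
    finally show "(\<integral>w\<in>D. (indicator A (U w) * indicator C (Y w) :: real) \<partial>M) =
        (\<integral>w\<in>D. p * real_cond_exp M FX (\<lambda>w. indicator C (Y w)) w \<partial>M)"
      by simp
  qed simp
  \<comment> \<open>Taking C = \<open>space T\<close> in \<open>key\<close> shows that E[1_A(U)|X]
    is the constant \<open>p\<close>.\<close>
  have ind1: "indicator (space T) (Y w) = (1 :: real)" if "w \<in> space M" for w
    using that measurable_space[OF Y] by simp
  have "AE w in M. real_cond_exp M FX (\<lambda>w. indicator A (U w)) w =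
      real_cond_exp M FX (\<lambda>w. indicator A (U w) * indicator (space T) (Y w)) w"
    using ind1 by (intro FX.real_cond_exp_cong) auto
  moreover have "AE w in M. real_cond_exp M FX (\<lambda>w. indicator (space T) (Y w)) w =
      real_cond_exp M FX (\<lambda>_. 1) w"
    using ind1 by (intro FX.real_cond_exp_cong) auto
  moreover have "AE w in M. real_cond_exp M FX (\<lambda>_. 1) w = 1"
    by (rule FX.real_cond_exp_F_meas) simp_all
  ultimately show "AE w in M. cond_expect M S X (\<lambda>w. indicator A (U w) * indicator B (Y w)) w =
      cond_expect M S X (\<lambda>w. indicator A (U w)) w * cond_expect M S X (\<lambda>w. indicator B (Y w)) w"
    using key[OF B] key[OF sets.top]
    unfolding cond_expect_def FX_def[symmetric]
    by eventually_elim simp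
qed fact+

section \<open>Extended logarithms of ratios\<close>

text \<open>If e = 0 the ratio is infinite and the bound is trivial; if e > 0 the last hypothesis
  makes \<open>k\<close> positive, and real logarithms apply.\<close>

lemma ereal_ln_divide_ge:
  assumes "0 < v" "0 \<le> e" "e \<le> k * v"
  shows "- ereal_ln (ereal k) \<le> ereal_ln (ereal v / ereal e)"
proof (cases "e = 0")
  case True
  then show ?thesis
    using assms(1) by (simp add: ereal_ln_def divide_ereal_def)
next
  case False
  with assms have "0 < e" by simp
  with assms have "0 < k * v" by linarith
  with \<open>0 < v\<close> have "0 < k"
    by (simp add: zero_less_mult_iff)
  have "ln e \<le> ln (k * v)"
    using assms \<open>0 < e\<close> by simp
  then have "- ln k \<le> ln (v / e)"
    using \<open>0 < k\<close> \<open>0 < v\<close> \<open>0 < e\<close> by (simp add: ln_mult ln_div)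
  then show ?thesis
    using \<open>0 < k\<close> \<open>0 < v\<close> \<open>0 < e\<close> by (simp add: ereal_ln_def not_le)
qed

text \<open>The case k = 0 corresponds to \<rho> = 1, where the right-hand side is infinite;
  otherwise the error \<open>e\<close> cannot vanish.\<close>

lemma ereal_ln_divide_le:
  assumes "0 < v" "0 \<le> k" "k * v \<le> e"
  shows "ereal_ln (ereal v / ereal e) \<le> - ereal_ln (ereal k)"
proof (cases "k = 0")
  case True
  then show ?thesis
    by (simp add: ereal_ln_def)
next
  case False
  with assms have "0 < k" by simp
  with assms have "0 < k * v" by simp
  with assms have "0 < e" by linarith
  have "ln (k * v) \<le> ln e"
    using assms \<open>0 < e\<close> \<open>0 < k * v\<close> by simp
  then have "ln (v / e) \<le> - ln k"
    using \<open>0 < k\<close> \<open>0 < v\<close> \<open>0 < e\<close> by (simp add: ln_mult ln_div)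
  then show ?thesis
    using \<open>0 < k\<close> \<open>0 < v\<close> \<open>0 < e\<close> by (simp add: ereal_ln_def not_le)
qed

section \<open>Range of the correlations\<close>

lemma correlation_le_1:
  assumes "prob_space P" and P: "sets P = sets (S \<Otimes>\<^sub>M T)" and "c \<in> correlations S T P"
  shows "c \<le> 1"
proof -
  interpret prob_space P by fact
  have Pm[measurable_cong]: "sets P = sets (S \<Otimes>\<^sub>M T)" by fact
  obtain f g where [measurable]: "f \<in> borel_measurable S" "g \<in> borel_measurable T"
    and f2: "expectation (\<lambda>(x, y). (f x)\<^sup>2) = 1" and g2: "expectation (\<lambda>(x, y). (g y)\<^sup>2) = 1"
    and c: "c = expectation (\<lambda>(x, y). f x * g y)"
    using assms(3) by (auto simp: correlations_def)
  have int: "integrable P (\<lambda>(x, y). (f x)\<^sup>2)" "integrable P (\<lambda>(x, y). (g y)\<^sup>2)"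
    using f2 g2 not_integrable_integral_eq zero_neq_one by metis+
  have "c\<^sup>2 \<le> 1"
    using inner_unit_power2_le[of "\<lambda>z. f (fst z)" P "\<lambda>z. g (snd z)"] int f2 g2
    by (simp add: c split_beta')
  then show ?thesis
    by (simp add: abs_square_le_1)
qed

text \<open>This symmetry makes the supremum of a nonempty set of correlations nonnegative, so that
  inequalities for \<rho> may be squared.\<close>

lemma uminus_correlation:
  assumes "c \<in> correlations S T P"
  shows "- c \<in> correlations S T P"
proof -
  obtain f g where fg: "f \<in> borel_measurable S" "g \<in> borel_measurable T"
    "prob_space.expectation P (\<lambda>(x, y). f x) = 0" "prob_space.expectation P (\<lambda>(x, y). g y) = 0"
    "prob_space.expectation P (\<lambda>(x, y). (f x)\<^sup>2) = 1" "prob_space.expectation P (\<lambda>(x, y). (g y)\<^sup>2) = 1"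
    "c = prob_space.expectation P (\<lambda>(x, y). f x * g y)"
    using assms by (auto simp: correlations_def)
  then show ?thesis
    unfolding correlations_def
    by (intro CollectI exI[of _ "\<lambda>x. - f x"] exI[of _ g]) (simp add: split_beta')
qed

lemma maximal_correlation_bounds:
  assumes "prob_space P" and "sets P = sets (S \<Otimes>\<^sub>M T)"
  shows "0 \<le> maximal_correlation S T P" "maximal_correlation S T P \<le> 1"
    and "\<And>c. c \<in> correlations S T P \<Longrightarrow> c \<le> maximal_correlation S T P"
proof -
  have bdd: "bdd_above (correlations S T P)"
    using correlation_le_1[OF assms] by (rule bdd_aboveI)
  show upper: "c \<le> maximal_correlation S T P" if "c \<in> correlations S T P" for c
    using that cSup_upper[OF that bdd] by (auto simp: maximal_correlation_def)
  show "maximal_correlation S T P \<le> 1"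
    using cSup_least[of "correlations S T P" 1] correlation_le_1[OF assms]
    by (auto simp: maximal_correlation_def)
  show "0 \<le> maximal_correlation S T P"
  proof (cases "correlations S T P = {}")
    case False
    then obtain c where "c \<in> correlations S T P" by auto
    then show ?thesis
      using upper[of c] upper[OF uminus_correlation, of c] by linarith
  qed (simp add: maximal_correlation_def)
qed

section \<open>Laws competing in the leakage\<close>

lemma leakage_law_mmse_ge:
  assumes "prob_space P" and P: "sets P = sets (S \<Otimes>\<^sub>M T)" and Q: "Q \<in> leakage_laws S T P"
  defines "v \<equiv> prob_space.variance Q (\<lambda>(u, x, y). u)"
  shows "(1 - (maximal_correlation S T P)\<^sup>2) * v \<le> mmse Q T (\<lambda>(u, x, y). u) (\<lambda>(u, x, y). y)"
proof -
  interpret Q: prob_space Q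
    using Q by (simp add: leakage_laws_def)
  have [measurable_cong]: "sets Q = sets (borel \<Otimes>\<^sub>M (S \<Otimes>\<^sub>M T))"
    and PQ: "distr Q (S \<Otimes>\<^sub>M T) (\<lambda>(u, x, y). (x, y)) = P"
    and mc: "markov_chain Q borel S T (\<lambda>(u, x, y). u) (\<lambda>(u, x, y). x) (\<lambda>(u, x, y). y)"
    and U2: "integrable Q (\<lambda>(u, x, y). u\<^sup>2)"
    using Q by (auto simp: leakage_laws_def)
  define U :: "real \<times> 'a \<times> 'b \<Rightarrow> real" where "U = (\<lambda>(u, x, y). u)"
  define X :: "real \<times> 'a \<times> 'b \<Rightarrow> 'a" where "X = (\<lambda>(u, x, y). x)"
  define Y :: "real \<times> 'a \<times> 'b \<Rightarrow> 'b" where "Y = (\<lambda>(u, x, y). y)"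
  have [measurable]: "U \<in> borel_measurable Q" "X \<in> measurable Q S" "Y \<in> measurable Q T"
    unfolding U_def X_def Y_def by measurable
  have transfer: "(\<integral>z. h z \<partial>P) = (\<integral>w. h (X w, Y w) \<partial>Q)"
    if [measurable]: "h \<in> borel_measurable (S \<Otimes>\<^sub>M T)" for h :: "'a \<times> 'b \<Rightarrow> real"
    by (subst PQ[symmetric], subst integral_distr) (auto simp: X_def Y_def split_beta')
  have mc': "markov_chain Q borel S T U X Y" and U2': "integrable Q (\<lambda>w. (U w)\<^sup>2)"
    using mc U2 by (simp_all add: U_def X_def Y_def split_beta')
  have "Q.expectation (\<lambda>w. (cond_expect Q T Y U w - Q.expectation U)\<^sup>2) \<le>
      (maximal_correlation S T P)\<^sup>2 * Q.variance U"
  proof (rule Q.markov_chain_cond_expect_power2_le[OF mc' U2'])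
    show "0 \<le> maximal_correlation S T P"
      by (rule maximal_correlation_bounds) fact+
    fix f :: "'a \<Rightarrow> real" and g :: "'b \<Rightarrow> real"
    assume [measurable]: "f \<in> borel_measurable S" "g \<in> borel_measurable T"
      and "Q.expectation (\<lambda>w. f (X w)) = 0" "Q.expectation (\<lambda>w. g (Y w)) = 0"
      "Q.expectation (\<lambda>w. (f (X w))\<^sup>2) = 1" "Q.expectation (\<lambda>w. (g (Y w))\<^sup>2) = 1"
    then have "Q.expectation (\<lambda>w. f (X w) * g (Y w)) \<in> correlations S T P"
      unfolding correlations_def
      by (intro CollectI exI[of _ f] exI[of _ g]) (simp add: transfer split_beta')
    then show "Q.expectation (\<lambda>w. f (X w) * g (Y w)) \<le> maximal_correlation S T P"
      by (rule maximal_correlation_bounds(3)[OF assms(1,2)])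
  qed
  moreover have "mmse Q T U Y = Q.variance U -
      Q.expectation (\<lambda>w. (cond_expect Q T Y U w - Q.expectation U)\<^sup>2)"
    using U2' by (intro Q.mmse_eq) simp_all
  ultimately show ?thesis
    by (simp add: v_def left_diff_distrib flip: U_def Y_def)
qed

lemma correlation_leakage_law:
  assumes "prob_space P" and P: "sets P = sets (S \<Otimes>\<^sub>M T)" and c: "c \<in> correlations S T P"
  obtains Q where "Q \<in> leakage_laws S T P" "prob_space.variance Q (\<lambda>(u, x, y). u) = 1"
    "mmse Q T (\<lambda>(u, x, y). u) (\<lambda>(u, x, y). y) \<le> 1 - c\<^sup>2"
proof -
  interpret P: prob_space P by fact
  have Pm[measurable_cong]: "sets P = sets (S \<Otimes>\<^sub>M T)" by fact
  obtain f g where [measurable]: "f \<in> borel_measurable S" "g \<in> borel_measurable T"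
    and f1: "P.expectation (\<lambda>(x, y). f x) = 0"
    and f2: "P.expectation (\<lambda>(x, y). (f x)\<^sup>2) = 1" and g2: "P.expectation (\<lambda>(x, y). (g y)\<^sup>2) = 1"
    and c: "c = P.expectation (\<lambda>(x, y). f x * g y)"
    using c by (auto simp: correlations_def)
  define U :: "real \<times> 'a \<times> 'b \<Rightarrow> real" where "U = (\<lambda>(u, x, y). u)"
  define X :: "real \<times> 'a \<times> 'b \<Rightarrow> 'a" where "X = (\<lambda>(u, x, y). x)"
  define Y :: "real \<times> 'a \<times> 'b \<Rightarrow> 'b" where "Y = (\<lambda>(u, x, y). y)"
  \<comment> \<open>The image of \<open>P\<close> under this map is the law of (f(X), X, Y), carried
    by the graph of \<open>f\<close>.\<close>
  define \<phi> where "\<phi> z = (f (fst z), fst z, snd z)" for z :: "'a \<times> 'b"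
  define Q where "Q = distr P (borel \<Otimes>\<^sub>M (S \<Otimes>\<^sub>M T)) \<phi>"
  have \<phi>[measurable]: "\<phi> \<in> measurable P (borel \<Otimes>\<^sub>M (S \<Otimes>\<^sub>M T))"
    unfolding \<phi>_def[abs_def] by measurable
  interpret Q: prob_space Q
    unfolding Q_def by (rule P.prob_space_distr) simp
  have sets_Q[measurable_cong]: "sets Q = sets (borel \<Otimes>\<^sub>M (S \<Otimes>\<^sub>M T))"
    by (simp add: Q_def)
  have [measurable]: "U \<in> borel_measurable (borel \<Otimes>\<^sub>M (S \<Otimes>\<^sub>M T))"
    "X \<in> measurable (borel \<Otimes>\<^sub>M (S \<Otimes>\<^sub>M T)) S" "Y \<in> measurable (borel \<Otimes>\<^sub>M (S \<Otimes>\<^sub>M T)) T"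
    unfolding U_def X_def Y_def by measurable
  have [simp]: "U (\<phi> z) = f (fst z)" "X (\<phi> z) = fst z" "Y (\<phi> z) = snd z" for z
    by (simp_all add: U_def X_def Y_def \<phi>_def split_beta')
  have "AE w in Q. U w = f (X w)"
    unfolding Q_def by (subst AE_distr_iff) simp_all
  then have mc: "markov_chain Q borel S T U X Y"
    by (intro Q.markov_chain_of_function[where f = f]) simp_all
  have U1: "Q.expectation U = 0" and U2: "Q.expectation (\<lambda>w. (U w)\<^sup>2) = 1"
    and gY2: "Q.expectation (\<lambda>w. (g (Y w))\<^sup>2) = 1" and UgY: "Q.expectation (\<lambda>w. U w * g (Y w)) = c"
    using f1 f2 g2 by (simp_all add: Q_def integral_distr split_beta' c)
  have U2i: "integrable Q (\<lambda>w. (U w)\<^sup>2)"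
    using U2 not_integrable_integral_eq zero_neq_one by metis
  have var: "Q.variance U = 1"
    by (simp add: U1 U2)
  have "distr Q (S \<Otimes>\<^sub>M T) (\<lambda>(u, x, y). (x, y)) = distr P (S \<Otimes>\<^sub>M T) (\<lambda>z. z)"
    unfolding Q_def
    by (subst distr_distr) (auto simp: comp_def \<phi>_def split_beta' P intro!: distr_cong)
  also have "\<dots> = P"
    by (rule distr_id2) (simp add: P)
  finally have "distr Q (S \<Otimes>\<^sub>M T) (\<lambda>(u, x, y). (x, y)) = P" .
  then have "Q \<in> leakage_laws S T P"
    using mc U2i var Q.prob_space_axioms sets_Q
    by (simp add: leakage_laws_def U_def X_def Y_def split_beta')
  moreover have "mmse Q T U Y \<le> 1 - c\<^sup>2"
    using Q.mmse_le_of_correlation[of U Y T g] U2i U2 gY2 UgY by simp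
  ultimately show thesis
    using that var by (simp add: U_def Y_def split_beta')
qed

text \<open>An empty supremum would be -\<infinity>, whereas the formula gives 0 at \<rho> = 0. If X
  is almost surely constant, no function of X has positive variance, so U must bring its own
  randomness.\<close>

lemma leakage_laws_nonempty:
  assumes "prob_space P" and P: "sets P = sets (S \<Otimes>\<^sub>M T)"
  shows "leakage_laws S T P \<noteq> {}"
proof -
  interpret P: prob_space P by fact
  \<comment> \<open>The values 1 and -1 make the coin centred with variance 1.\<close>
  define C where "C = distr (measure_pmf (bernoulli_pmf (1/2))) borel (\<lambda>b. if b then 1 else - 1 :: real)"
  interpret C: prob_space C
    unfolding C_def by (rule measure_pmf.prob_space_distr) simp
  interpret CP: pair_prob_space C P ..
  have [measurable_cong]: "sets P = sets (S \<Otimes>\<^sub>M T)" "sets C = sets borel"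
    by (simp_all add: P C_def)
  define Q where "Q = C \<Otimes>\<^sub>M P"
  interpret Q: prob_space Q
    unfolding Q_def by (rule CP.prob_space_axioms)
  have sets_Q[measurable_cong]: "sets Q = sets (borel \<Otimes>\<^sub>M (S \<Otimes>\<^sub>M T))"
    unfolding Q_def by (rule sets_pair_measure_cong) (simp_all add: P C_def)
  have space_Q: "space Q = UNIV \<times> space S \<times> space T"
    using sets_eq_imp_space_eq[OF sets_Q] by (simp add: space_pair_measure)
  define U :: "real \<times> 'a \<times> 'b \<Rightarrow> real" where "U = (\<lambda>(u, x, y). u)"
  define X :: "real \<times> 'a \<times> 'b \<Rightarrow> 'a" where "X = (\<lambda>(u, x, y). x)"
  define Y :: "real \<times> 'a \<times> 'b \<Rightarrow> 'b" where "Y = (\<lambda>(u, x, y). y)"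
  have [measurable]: "U \<in> borel_measurable Q" "X \<in> measurable Q S" "Y \<in> measurable Q T"
    unfolding U_def X_def Y_def by measurable
  have prod: "Q.prob (A \<times> D) = C.prob A * P.prob D" if "A \<in> sets borel" "D \<in> sets (S \<Otimes>\<^sub>M T)" for A D
    using that unfolding Q_def
    by (simp add: measure_def P.emeasure_pair_measure_Times P C_def enn2real_mult)
  have mc: "markov_chain Q borel S T U X Y"
  proof (rule Q.markov_chain_of_indep)
    fix A :: "real set" and B D assume [measurable]: "A \<in> sets borel" and BD: "B \<in> sets S" "D \<in> sets T"
    then have sub: "B \<subseteq> space S" "D \<subseteq> space T"
      by (auto dest: sets.sets_into_space)
    have "{w \<in> space Q. U w \<in> A \<and> X w \<in> B \<and> Y w \<in> D} = A \<times> (B \<times> D)"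
      "{w \<in> space Q. U w \<in> A} = A \<times> (space S \<times> space T)"
      "{w \<in> space Q. X w \<in> B \<and> Y w \<in> D} = UNIV \<times> (B \<times> D)"
      using sub by (auto simp: U_def X_def Y_def space_Q)
    moreover have "P.prob (space S \<times> space T) = 1"
      using P.prob_space sets_eq_imp_space_eq[OF P] by (simp add: space_pair_measure)
    moreover have "C.prob UNIV = 1"
      using C.prob_space by (simp add: C_def)
    ultimately show "Q.prob {w \<in> space Q. U w \<in> A \<and> X w \<in> B \<and> Y w \<in> D} =
        Q.prob {w \<in> space Q. U w \<in> A} * Q.prob {w \<in> space Q. X w \<in> B \<and> Y w \<in> D}"
      using BD by (simp add: prod)
  qed simp_all
  have marg: "distr Q (S \<Otimes>\<^sub>M T) (\<lambda>(u, x, y). (x, y)) = P"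
  proof (rule measure_eqI)
    have m: "(\<lambda>(u, x, y). (x, y)) \<in> measurable Q (S \<Otimes>\<^sub>M T)"
      by measurable
    fix D assume "D \<in> sets (distr Q (S \<Otimes>\<^sub>M T) (\<lambda>(u, x, y). (x, y)))"
    then have D: "D \<in> sets (S \<Otimes>\<^sub>M T)" by simp
    have "(\<lambda>(u, x, y). (x, y)) -` D \<inter> space Q = space C \<times> D"
      using sets.sets_into_space[OF D] by (auto simp: space_Q space_pair_measure C_def)
    moreover have "emeasure Q (space C \<times> D) = emeasure P D"
      using D unfolding Q_def by (simp add: P.emeasure_pair_measure_Times P C.emeasure_space_1)
    ultimately show "emeasure (distr Q (S \<Otimes>\<^sub>M T) (\<lambda>(u, x, y). (x, y))) D = emeasure P D"
      by (simp only: emeasure_distr[OF m D])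
  qed (simp add: P)
  have dist: "distr Q C fst = C"
    unfolding Q_def by (rule P.distr_pair_fst)
  have expect: "Q.expectation (\<lambda>w. h (U w)) = (h 1 + h (- 1)) / 2"
    if [measurable]: "h \<in> borel_measurable borel" for h :: "real \<Rightarrow> real"
  proof -
    have "Q.expectation (\<lambda>w. h (fst w)) = (\<integral>u. h u \<partial>distr Q C fst)"
      by (subst integral_distr) simp_all
    also have "\<dots> = (\<integral>u. h u \<partial>C)"
      by (simp only: dist)
    also have "\<dots> = (h 1 + h (- 1)) / 2"
      unfolding C_def by (subst integral_distr) simp_all
    finally show ?thesis
      by (simp add: U_def split_beta')
  qed
  have "integrable C (\<lambda>u. u\<^sup>2)"
    unfolding C_def by (subst integrable_distr_eq) (auto intro: integrable_measure_pmf_finite)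
  then have "integrable (distr Q C fst) (\<lambda>u. u\<^sup>2)"
    by (simp only: dist)
  then have U2i: "integrable Q (\<lambda>w. (U w)\<^sup>2)"
    by (subst (asm) integrable_distr_eq) (simp_all add: U_def split_beta')
  have "Q.expectation U = 0" "Q.expectation (\<lambda>w. (U w)\<^sup>2) = 1"
    using expect[of "\<lambda>u. u"] expect[of "\<lambda>u. u\<^sup>2"] by simp_all
  then have "Q \<in> leakage_laws S T P"
    using mc U2i marg Q.prob_space_axioms sets_Q
    by (simp add: leakage_laws_def U_def X_def Y_def split_beta')
  then show ?thesis by auto
qed

theorem lemma16:
  fixes S :: "'x measure" and T :: "'y measure" and P :: "('x \<times> 'y) measure"
  assumes "prob_space P"
    and "sets P = sets (S \<Otimes>\<^sub>M T)"
  shows "variance_leakage S T P = - ereal_ln (ereal (1 - (maximal_correlation S T P)\<^sup>2))"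
proof (rule antisym)
  define \<rho> where "\<rho> = maximal_correlation S T P"
  define L where "L = variance_leakage S T P"
  note \<rho> = maximal_correlation_bounds[OF assms, folded \<rho>_def]
  have le_L: "- ereal_ln (ereal k) \<le> L"
    if "Q \<in> leakage_laws S T P"
      "mmse Q T (\<lambda>(u, x, y). u) (\<lambda>(u, x, y). y) \<le> k * prob_space.variance Q (\<lambda>(u, x, y). u)" for Q k
  proof -
    have "0 \<le> mmse Q T (\<lambda>(u, x, y). u) (\<lambda>(u, x, y). y)"
      by (simp add: mmse_def)
    then have "- ereal_ln (ereal k) \<le> ereal_ln (ereal (prob_space.variance Q (\<lambda>(u, x, y). u)) /
        ereal (mmse Q T (\<lambda>(u, x, y). u) (\<lambda>(u, x, y). y)))"
      using that by (intro ereal_ln_divide_ge) (auto simp: leakage_laws_def)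
    also have "\<dots> \<le> L"
      unfolding L_def variance_leakage_def by (rule SUP_upper) fact
    finally show ?thesis .
  qed
  show "variance_leakage S T P \<le> - ereal_ln (ereal (1 - \<rho>\<^sup>2))"
    unfolding variance_leakage_def
  proof (rule SUP_least)
    fix Q assume Q: "Q \<in> leakage_laws S T P"
    then show "ereal_ln (ereal (prob_space.variance Q (\<lambda>(u, x, y). u)) /
        ereal (mmse Q T (\<lambda>(u, x, y). u) (\<lambda>(u, x, y). y))) \<le> - ereal_ln (ereal (1 - \<rho>\<^sup>2))"
      using leakage_law_mmse_ge[OF assms Q] \<rho>
      by (intro ereal_ln_divide_le) (auto simp: leakage_laws_def \<rho>_def abs_square_le_1)
  qed
  obtain Q where Q: "Q \<in> leakage_laws S T P"
    using leakage_laws_nonempty[OF assms] by auto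
  interpret Q: prob_space Q
    using Q by (simp add: leakage_laws_def)
  \<comment> \<open>This is Pythagoras centred at the mean and holds for every competing law; the
    coin only guarantees that there is one.\<close>
  have "mmse Q T (\<lambda>(u, x, y). u) (\<lambda>(u, x, y). y) \<le> 1 * Q.variance (\<lambda>(u, x, y). u)"
  proof -
    have [measurable_cong]: "sets Q = sets (borel \<Otimes>\<^sub>M (S \<Otimes>\<^sub>M T))"
      using Q by (simp add: leakage_laws_def)
    show ?thesis
      using Q by (subst Q.mmse_eq[where m = "Q.expectation (\<lambda>(u, x, y). u)"])
        (auto simp: leakage_laws_def split_beta')
  qed
  from le_L[OF Q this] have "0 \<le> L"
    by (simp add: ereal_ln_def flip: zero_ereal_def)
  show "- ereal_ln (ereal (1 - \<rho>\<^sup>2)) \<le> L"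
  \<comment> \<open>An infinite L is trivial and -\<infinity> is excluded by 0 \<le> L. For finite L
    the cap on the correlations also rules out \<rho> = 1.\<close>
  proof (cases L)
    case (real l)
    have "c \<le> sqrt (1 - exp (- l))" if c: "c \<in> correlations S T P" for c
    proof -
      obtain Q where "Q \<in> leakage_laws S T P" "prob_space.variance Q (\<lambda>(u, x, y). u) = 1"
        "mmse Q T (\<lambda>(u, x, y). u) (\<lambda>(u, x, y). y) \<le> 1 - c\<^sup>2"
        by (rule correlation_leakage_law[OF assms c])
      then have "- ereal_ln (ereal (1 - c\<^sup>2)) \<le> ereal l"
        using le_L[of Q "1 - c\<^sup>2"] real by simp
      \<comment> \<open>If 1 - c^2 were not positive, \<open>- ereal_ln\<close> would be \<infinity>
        and could not lie below \<open>l\<close>.\<close>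
      then have "0 < 1 - c\<^sup>2" "- ln (1 - c\<^sup>2) \<le> l"
        by (auto simp: ereal_ln_def split: if_splits)
      then have "exp (- l) \<le> 1 - c\<^sup>2"
        by (subst ln_ge_iff[symmetric]) simp_all
      then show ?thesis
        by (intro real_le_rsqrt) simp
    qed
    then have "\<rho> \<le> sqrt (1 - exp (- l))"
      \<comment> \<open>If there are no correlations, \<rho> = 0 by convention, and 0 \<le> l makes
        the square root nonnegative.\<close>
      using \<open>0 \<le> L\<close> real by (auto simp: \<rho>_def maximal_correlation_def intro!: cSup_least)
    then have "\<rho>\<^sup>2 \<le> 1 - exp (- l)"
      using \<rho>(1) \<open>0 \<le> L\<close> real power_mono[of \<rho> "sqrt (1 - exp (- l))" 2] by simp
    then have le: "exp (- l) \<le> 1 - \<rho>\<^sup>2" by simp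
    then have "0 < 1 - \<rho>\<^sup>2"
      using exp_gt_zero[of "- l"] by linarith
    with le have "- l \<le> ln (1 - \<rho>\<^sup>2)"
      by (simp add: ln_ge_iff)
    then show ?thesis
      using \<open>0 < 1 - \<rho>\<^sup>2\<close> real by (simp add: ereal_ln_def)
  qed (use \<open>0 \<le> L\<close> in auto)
qed

end
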